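(* Let $W_n$ be the wheel graph of order $n\ge 4$. Then $$A(W_n;x)=A(E_1;x)+A(C_{n-1};x)+\sum_{k=2}^{\lfloor n/2\rfloor}\binom{n-1}{k-1}x^{2k-1}+\sum_{k=\lfloor n/2\rfloor+1}^{n-1}a_{n,k}\,x^{n-1}+\xi_n\,b_{n,(n+1)/2}\,x^{n}+\sum_{k=\lceil n/2\rceil+1}^{n-1}b_{n,k}\,x^{n+1}+x^{n+3},$$ where $\xi_n=0$ if $n$ is even and $\xi_n=1$ if $n$ is odd, $$b_{n,k}=(n-1)\sum_{r=1}^{\lfloor (k-1)/2\rfloor}\frac{\binom{n-k-1}{r-1}\binom{k-1-r}{r}}{k-1-r}\qquad\text{and}\qquad a_{n,k}=\binom{n-1}{k-1}-b_{n,k}.$$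
   Context: All graphs are finite, simple, with nonempty vertex set. For a graph $G=(V,E)$ of order $n=|V|$, a vertex $v\in V$ and a set $X\subseteq V$, let $\delta_X(v)$ denote the number of neighbors of $v$ lying in $X$; write $\bar S=V\setminus S$ for $S\subseteq V$, and let $\Delta$ be the maximum degree of $G$. Put $\mathcal K=[-\Delta,\Delta]\cap\mathbb Z$. For $k\in\mathcal K$, a nonempty set $S\subseteq V$ is a defensive $k$-alliance in $G$ if $\delta_S(v)\ge\delta_{\bar S}(v)+k$ for every $v\in S$. For a nonempty $S\subseteq V$, its exact index of alliance is $k_S=\max\{k\in\mathcal K : S\text{ is a defensive }k\text{-alliance}\}$ (this set of $k$ is always nonempty), and $S$ is called an exact defensive $k_S$-alliance. $S$ is called connected if the subgraph of $G$ induced by $S$ is connected. Let $A_k(G)$ be the number of connected exact defensive $k$-alliances in $G$. The alliance polynomial of $G$ is $$A(G;x)=\sum_{k\in\mathcal K}A_k(G)\,x^{n+k}.$$ $E_1$ is the graph with one vertex (and no edges), and $C_{n-1}$ is the cycle on $n-1$ vertices; $A(E_1;x)$ and $A(C_{n-1};x)$ are the alliance polynomials of these graphs themselves (computed with their own orders $1$ and $n-1$). The wheel graph $W_n$ of order $n\ge4$ is the join $E_1+C_{n-1}$, i.e. the cycle $C_{n-1}$ together with one additional (central) vertex adjacent to all vertices of the cycle. Conventions: $\binom{m}{j}=0$ for integers $j>m\ge0$, empty sums are $0$, and the term $\xi_n b_{n,(n+1)/2}x^n$ is absent when $n$ is even. *)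

theory Defs
  imports
    "Graph_Theory.Graph_Theory"
    "HOL-Computational_Algebra.Polynomial"
begin

section \<open>Defensive alliances and the alliance polynomial\<close>

text \<open>
  A simple graph is represented as in \<^theory>\<open>Graph_Theory.Pair_Digraph\<close>: a symmetric loopfree
  finite digraph without parallel arcs (locale \<^locale>\<open>pair_graph\<close>), so that each edge corresponds
  to two opposite arcs and the degree of a vertex is its out-degree.
\<close>

definition degree_in :: "'a pair_pre_digraph \<Rightarrow> 'a set \<Rightarrow> 'a \<Rightarrow> nat" where
  "degree_in G X v = card {u \<in> X. (v, u) \<in> parcs G}"

definition max_degree :: "'a pair_pre_digraph \<Rightarrow> nat" where
  "max_degree G = Max (out_degree (with_proj G) ` pverts G)"

definition alliance_range :: "'a pair_pre_digraph \<Rightarrow> int set" where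
  "alliance_range G = {- int (max_degree G) .. int (max_degree G)}"

definition defensive_alliance :: "'a pair_pre_digraph \<Rightarrow> int \<Rightarrow> 'a set \<Rightarrow> bool" where
  "defensive_alliance G k S \<longleftrightarrow> S \<noteq> {} \<and> S \<subseteq> pverts G \<and>
     (\<forall>v \<in> S. int (degree_in G S v) \<ge> int (degree_in G (pverts G - S) v) + k)"

definition exact_index :: "'a pair_pre_digraph \<Rightarrow> 'a set \<Rightarrow> int" where
  "exact_index G S = Max {k \<in> alliance_range G. defensive_alliance G k S}"

definition exact_defensive_alliance :: "'a pair_pre_digraph \<Rightarrow> int \<Rightarrow> 'a set \<Rightarrow> bool" where
  "exact_defensive_alliance G k S \<longleftrightarrow> S \<noteq> {} \<and> S \<subseteq> pverts G \<and> exact_index G S = k"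

text \<open>The name \<open>connected\<close> is qualified because of its topological namesake.\<close>

definition connected_set :: "'a pair_pre_digraph \<Rightarrow> 'a set \<Rightarrow> bool" where
  "connected_set G S \<longleftrightarrow> Digraph_Component.connected (with_proj G \<restriction> S)"

definition num_alliances :: "'a pair_pre_digraph \<Rightarrow> int \<Rightarrow> nat" where
  "num_alliances G k = card {S. connected_set G S \<and> exact_defensive_alliance G k S}"

text \<open>
  For a nonempty simple graph every exponent is positive, since the maximum degree is smaller than
  the order; hence the conversion by \<^const>\<open>nat\<close> does not truncate.
  The coefficients are taken in the rationals because the identity below contains fractions.
\<close>

definition alliance_poly :: "'a pair_pre_digraph \<Rightarrow> rat poly" where
  "alliance_poly G = (\<Sum>k \<in> alliance_range G.
     monom (of_nat (num_alliances G k)) (nat (int (card (pverts G)) + k)))"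

section \<open>The graphs\<close>

definition E1 :: "unit pair_pre_digraph" where
  "E1 = \<lparr> pverts = {()}, parcs = {} \<rparr>"

text \<open>This is the cycle on \<open>m\<close> vertices when \<open>m \<ge> 3\<close>.\<close>

definition cycle_graph :: "nat \<Rightarrow> nat pair_pre_digraph" where
  "cycle_graph m = \<lparr> pverts = {..<m},
     parcs = {(i, j). i < m \<and> j < m \<and> (j = (i + 1) mod m \<or> i = (j + 1) mod m)} \<rparr>"

definition graph_join ::
  "'a pair_pre_digraph \<Rightarrow> 'b pair_pre_digraph \<Rightarrow> ('a + 'b) pair_pre_digraph" where
  "graph_join G H = \<lparr> pverts = pverts G <+> pverts H,
     parcs = map_prod Inl Inl ` parcs G \<union> map_prod Inr Inr ` parcs H
       \<union> (Inl ` pverts G) \<times> (Inr ` pverts H) \<union> (Inr ` pverts H) \<times> (Inl ` pverts G) \<rparr>"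

definition wheel_graph :: "nat \<Rightarrow> (unit + nat) pair_pre_digraph" where
  "wheel_graph n = graph_join E1 (cycle_graph (n - 1))"

section \<open>The coefficients\<close>

text \<open>
  The subtractions on naturals do not truncate and the denominators are nonzero in the range
  \<open>1 \<le> k \<le> n - 1\<close>, \<open>1 \<le> r \<le> (k - 1) div 2\<close> where the coefficients are used.
\<close>

definition coeff_b :: "nat \<Rightarrow> nat \<Rightarrow> rat" where
  "coeff_b n k = of_nat (n - 1) * (\<Sum>r = 1..(k - 1) div 2.
     of_nat (((n - k - 1) choose (r - 1)) * ((k - 1 - r) choose r)) / of_nat (k - 1 - r))"

definition coeff_a :: "nat \<Rightarrow> nat \<Rightarrow> rat" where
  "coeff_a n k = of_nat ((n - 1) choose (k - 1)) - coeff_b n k"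

definition xi :: "nat \<Rightarrow> rat" where
  "xi n = (if even n then 0 else 1)"

section \<open>Well-formedness\<close>

lemma pair_graph_E1: "pair_graph E1"
  by unfold_locales (auto simp: E1_def symmetric_def sym_def)

lemma pair_graph_cycle_graph:
  assumes "m \<ge> 3"
  shows "pair_graph (cycle_graph m)"
proof -
  have "finite (parcs (cycle_graph m))"
    by (rule finite_subset[of _ "{..<m} \<times> {..<m}"]) (auto simp: cycle_graph_def)
  moreover have "Suc i mod m \<noteq> i" if "i < m" for i
    using that assms by (cases "Suc i = m") auto
  ultimately show ?thesis
    by unfold_locales (fastforce simp: cycle_graph_def symmetric_def sym_def)+
qed

lemma pair_graph_graph_join:
  assumes "pair_graph G" "pair_graph H"
  shows "pair_graph (graph_join G H)"
proof -
  interpret G: pair_graph G by fact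
  interpret H: pair_graph H by fact
  show ?thesis
    by unfold_locales
      (auto simp: graph_join_def symmetric_def sym_def G.pair_finite_verts H.pair_finite_verts
        G.pair_finite_arcs H.pair_finite_arcs dest: G.wellformed' H.wellformed' G.no_loops'
        H.no_loops' G.arcs_symmetric H.arcs_symmetric)
qed

lemma pair_graph_wheel_graph: "n \<ge> 4 \<Longrightarrow> pair_graph (wheel_graph n)"
  unfolding wheel_graph_def
  by (intro pair_graph_graph_join pair_graph_E1 pair_graph_cycle_graph) simp

lemma card_wheel_graph: "n \<ge> 4 \<Longrightarrow> card (pverts (wheel_graph n)) = n"
  by (simp add: wheel_graph_def graph_join_def E1_def cycle_graph_def card_Plus)

lemma out_degree_eq_degree_in:
  assumes "pair_graph G"
  shows "out_degree (with_proj G) v = degree_in G (pverts G) v"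
proof -
  interpret pair_graph G by fact
  have "out_arcs (with_proj G) v = Pair v ` {u \<in> pverts G. (v, u) \<in> parcs G}"
    by (auto simp: out_arcs_def dest: wellformed')
  then show ?thesis
    by (simp add: out_degree_def degree_in_def card_image inj_on_def)
qed

lemma exact_index_set_nonempty:
  assumes "pair_graph G" "S \<noteq> {}" "S \<subseteq> pverts G"
  shows "{k \<in> alliance_range G. defensive_alliance G k S} \<noteq> {}"
proof -
  interpret pair_graph G by fact
  have "degree_in G (pverts G - S) v \<le> max_degree G" if "v \<in> S" for v
  proof -
    have "degree_in G (pverts G - S) v \<le> degree_in G (pverts G) v"
      unfolding degree_in_def by (rule card_mono) (auto simp: pair_finite_verts)
    also have "\<dots> \<le> max_degree G"
      unfolding max_degree_def using that assms
      by (intro Max_ge) (auto simp: pair_finite_verts out_degree_eq_degree_in)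
    finally show ?thesis .
  qed
  then have "defensive_alliance G (- int (max_degree G)) S"
    using assms by (force simp: defensive_alliance_def)
  then show ?thesis
    by (auto simp: alliance_range_def)
qed

end

(*
  Connected sets avoiding the hub are the connected sets of the cycle; each of their vertices has
  the hub as one additional neighbour outside, so the index drops by one, which the larger order
  compensates. A set consisting of the hub and j rim vertices is always connected. With m = n - 1,
  the hub contributes the difference 2 j - m, and a rim vertex with c neighbours among the chosen
  rim vertices contributes 2 c - 1. Hence for 0 < j < m everything depends on whether some chosen rim
  vertex is isolated (c = 0); otherwise an end of a run has c = 1.

  The number of j-subsets of the cycle with r runs, all of length at least 2, is found by counting
  the pairs of such a set and the start of one of its runs: by rotation, r times this number
  is m times the number of sets in which a run starts at 0, and these are linear words.
*)
theory Submission
  imports Defs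
begin

section \<open>Exact indices\<close>

lemma in_symcl_iff: "(u, v) \<in> symcl R \<longleftrightarrow> (u, v) \<in> R \<or> (v, u) \<in> R"
  by (force simp: symcl_def)

text \<open>Connectedness of a digraph is strong connectedness of its symmetric closure. Unfolding
  it to \<open>rtrancl_on S\<close> makes explicit that paths stay inside \<open>S\<close> and that
  the empty set is excluded.\<close>

lemma connected_set_iff:
  "connected_set G S \<longleftrightarrow> S \<noteq> {} \<and> (\<forall>u \<in> S. \<forall>v \<in> S.
    (u, v) \<in> rtrancl_on S (symcl (parcs G \<inter> S \<times> S)))"
proof -
  have "parcs (mk_symmetric (with_proj G \<restriction> S)) = symcl (parcs G \<inter> S \<times> S)"
    by (intro set_eqI) (auto simp: parcs_mk_symmetric in_symcl_iff; blast)
  then show ?thesis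
    by (simp add: connected_set_def Digraph_Component.connected_def strongly_connected_def
        reachable_def)
qed

text \<open>Serves to transport connectedness along the embedding \<open>Inr\<close> of the cycle
  into the wheel.\<close>

lemma rtrancl_on_image_iff:
  assumes "inj f"
  shows "(f x, f y) \<in> rtrancl_on (f ` T) (map_prod f f ` R) \<longleftrightarrow> (x, y) \<in> rtrancl_on T R"
proof
  \<comment> \<open>The end point varies in the induction, so its preimage is built along the path;
    injectivity matches it with the tail of the next arc.\<close>
  have "(u, v) \<in> rtrancl_on (f ` T) (map_prod f f ` R) \<Longrightarrow> u = f x \<Longrightarrow>
    \<exists>y. v = f y \<and> (x, y) \<in> rtrancl_on T R" for u v
  proof (induction rule: rtrancl_on.induct)
    case (rtrancl_on_refl a)
    then show ?case using assms by (auto dest: injD)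
  next
    case (rtrancl_on_into_rtrancl_on a b c)
    then obtain y where y: "b = f y" "(x, y) \<in> rtrancl_on T R" by blast
    from rtrancl_on_into_rtrancl_on y assms obtain z where "(y, z) \<in> R" "c = f z" "z \<in> T"
      by (auto dest: injD)
    with y show ?case by (blast intro: rtrancl_on.rtrancl_on_into_rtrancl_on)
  qed
  then show "(f x, f y) \<in> rtrancl_on (f ` T) (map_prod f f ` R) \<Longrightarrow> (x, y) \<in> rtrancl_on T R"
    using assms by (auto dest: injD)
next
  assume "(x, y) \<in> rtrancl_on T R"
  then show "(f x, f y) \<in> rtrancl_on (f ` T) (map_prod f f ` R)"
    by (induction rule: rtrancl_on.induct)
      (force intro: rtrancl_on.rtrancl_on_into_rtrancl_on)+
qed

lemma pverts_graph_join [simp]: "pverts (graph_join G H) = pverts G <+> pverts H"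
  by (simp add: graph_join_def)

lemma parcs_graph_join [simp]:
  "(Inl a, Inl a') \<in> parcs (graph_join G H) \<longleftrightarrow> (a, a') \<in> parcs G"
  "(Inr b, Inr b') \<in> parcs (graph_join G H) \<longleftrightarrow> (b, b') \<in> parcs H"
  "(Inl a, Inr b) \<in> parcs (graph_join G H) \<longleftrightarrow> a \<in> pverts G \<and> b \<in> pverts H"
  "(Inr b, Inl a) \<in> parcs (graph_join G H) \<longleftrightarrow> a \<in> pverts G \<and> b \<in> pverts H"
  by (auto simp: graph_join_def)

lemma connected_set_graph_join_Inr:
  "connected_set (graph_join G H) (Inr ` T) \<longleftrightarrow> connected_set H T"
proof -
  have "symcl (parcs (graph_join G H) \<inter> Inr ` T \<times> Inr ` T) =
    map_prod Inr Inr ` symcl (parcs H \<inter> T \<times> T)"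
  proof (intro set_eqI)
    fix p
    show "p \<in> symcl (parcs (graph_join G H) \<inter> Inr ` T \<times> Inr ` T) \<longleftrightarrow>
      p \<in> map_prod Inr Inr ` symcl (parcs H \<inter> T \<times> T)"
      by (cases p) (force simp: in_symcl_iff map_prod_def image_iff split: prod.splits)
  qed
  then show ?thesis
    by (simp add: connected_set_iff rtrancl_on_image_iff)
qed

text \<open>Any two vertices are linked through \<open>c\<close>; the arcs back to \<open>c\<close>
  come from the symmetric closure. In the wheel, \<open>c\<close> is the hub.\<close>

lemma connected_set_if_dominating:
  assumes "c \<in> S" "\<And>v. v \<in> S \<Longrightarrow> v \<noteq> c \<Longrightarrow> (c, v) \<in> parcs G"
  shows "connected_set G S"
proof -
  let ?R = "symcl (parcs G \<inter> S \<times> S)"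
  have "(c, v) \<in> rtrancl_on S ?R \<and> (v, c) \<in> rtrancl_on S ?R" if "v \<in> S" for v
  proof (cases "v = c")
    case False
    then have "(c, v) \<in> ?R" "(v, c) \<in> ?R" using assms that by (auto simp: in_symcl_iff)
    then show ?thesis using assms that
      by (meson rtrancl_on_refl rtrancl_on_into_rtrancl_on)
  qed (use assms in auto)
  then show ?thesis
    using assms by (auto simp: connected_set_iff intro: rtrancl_on_trans)
qed

text \<open>The exact index of \<open>S\<close> is the minimum of this quantity over \<open>S\<close>.\<close>

definition alliance_slack :: "'a pair_pre_digraph \<Rightarrow> 'a set \<Rightarrow> 'a \<Rightarrow> int" where
  "alliance_slack G S v = int (degree_in G S v) - int (degree_in G (pverts G - S) v)"

section \<open>The exact index as smallest slack, and the polynomial as a sum over sets\<close>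

lemma finite_alliance_indices: "finite {k \<in> alliance_range G. P k}"
  by (rule finite_subset[of _ "alliance_range G"]) (auto simp: alliance_range_def)

text \<open>\<open>S\<close> is a defensive alliance for an index iff that index is at most every
  slack, so the largest such index is the smallest slack.\<close>

lemma exact_index_eqI:
  assumes "pair_graph G" "S \<subseteq> pverts G" "v \<in> S" "alliance_slack G S v = k"
    and "\<And>u. u \<in> S \<Longrightarrow> k \<le> alliance_slack G S u"
  shows "exact_index G S = k"
  unfolding exact_index_def
proof (rule Max_eqI)
  interpret pair_graph G by fact
  show "finite {k \<in> alliance_range G. defensive_alliance G k S}"
    by (rule finite_alliance_indices)
  show "l \<le> k" if "l \<in> {k \<in> alliance_range G. defensive_alliance G k S}" for l
    using that assms(3,4) by (force simp: defensive_alliance_def alliance_slack_def)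
  \<comment> \<open>Both degrees in a slack are at most the maximum degree, so their difference lies
    in \<open>alliance_range G\<close>.\<close>
  have le: "degree_in G X v \<le> max_degree G" if "X \<subseteq> pverts G" for X
  proof -
    have "degree_in G X v \<le> degree_in G (pverts G) v"
      unfolding degree_in_def using that finite_subset[OF _ pair_finite_verts]
      by (intro card_mono) (auto simp: pair_finite_verts)
    also have "\<dots> \<le> max_degree G"
      unfolding max_degree_def using assms(1-3)
      by (intro Max_ge) (auto simp: pair_finite_verts out_degree_eq_degree_in)
    finally show ?thesis .
  qed
  show "k \<in> {k \<in> alliance_range G. defensive_alliance G k S}"
    using le[of S] le[of "pverts G - S"] assms(2-5)
    by (force simp: alliance_range_def defensive_alliance_def alliance_slack_def)
qed

text \<open>Provides a minimising vertex where the index is not computed explicitly, as for subsets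
  of the cycle in \<open>exact_index_hubless\<close>.\<close>

lemma exact_index_attained:
  assumes "pair_graph G" "S \<subseteq> pverts G" "S \<noteq> {}"
  obtains v where "v \<in> S" "alliance_slack G S v = exact_index G S"
    "\<And>u. u \<in> S \<Longrightarrow> exact_index G S \<le> alliance_slack G S u"
proof -
  interpret pair_graph G by fact
  have fin: "finite (alliance_slack G S ` S)"
    using assms pair_finite_verts finite_subset by blast
  then have "Min (alliance_slack G S ` S) \<in> alliance_slack G S ` S"
    using assms by (intro Min_in) auto
  then obtain v where v: "v \<in> S" "alliance_slack G S v = Min (alliance_slack G S ` S)"
    by (metis imageE)
  then have "\<And>u. u \<in> S \<Longrightarrow> alliance_slack G S v \<le> alliance_slack G S u"
    using fin by simp
  with v that exact_index_eqI[OF assms(1,2) v(1)] show thesis by auto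
qed

lemma sum_monom_const:
  "(\<Sum>x \<in> A. monom (1 :: 'a :: comm_semiring_1) e) = monom (of_nat (card A)) e"
  by (simp add: of_nat_monom mult_monom)

text \<open>Each coefficient counts a fibre of \<open>exact_index\<close>, so the sum over indices
  unfolds into one monomial per connected set.\<close>

lemma alliance_poly_eq:
  assumes "pair_graph G"
  shows "alliance_poly G = (\<Sum>S | S \<subseteq> pverts G \<and> connected_set G S.
    monom 1 (nat (int (card (pverts G)) + exact_index G S)))"
proof -
  interpret pair_graph G by fact
  define C where "C = {S. S \<subseteq> pverts G \<and> connected_set G S}"
  have fin: "finite C"
    by (rule finite_subset[of _ "Pow (pverts G)"]) (auto simp: C_def pair_finite_verts)
  have ne: "S \<noteq> {}" if "S \<in> C" for S using that by (auto simp: C_def connected_set_iff)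
  \<comment> \<open>Regrouping by index must not lose a set whose index lies outside the
    range.\<close>
  have "exact_index G S \<in> alliance_range G" if "S \<in> C" for S
    using Max_in[OF finite_alliance_indices exact_index_set_nonempty[OF assms ne[OF that]]] that
    by (auto simp: exact_index_def C_def)
  then have sub: "exact_index G ` C \<subseteq> alliance_range G" by blast
  have num: "{S. connected_set G S \<and> exact_defensive_alliance G k S} = {S \<in> C. exact_index G S = k}" for k
    using ne by (auto simp: exact_defensive_alliance_def C_def)
  have "alliance_poly G = (\<Sum>k \<in> alliance_range G. \<Sum>S | S \<in> C \<and> exact_index G S = k.
    monom 1 (nat (int (card (pverts G)) + exact_index G S)))"
    unfolding alliance_poly_def num_alliances_def num sum_monom_const[symmetric]
    by (intro sum.cong) auto
  also have "\<dots> = (\<Sum>S \<in> C. monom 1 (nat (int (card (pverts G)) + exact_index G S)))"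
    by (rule sum.group[OF fin _ sub]) (simp add: alliance_range_def)
  finally show ?thesis by (simp add: C_def)
qed

section \<open>Subsets of a cycle without isolated points\<close>

text \<open>A word over booleans, read from left to right, is accepted if it does not end in a run, has \<open>r\<close> runs
  of \<^const>\<open>True\<close> left to start and all these runs have length at least 2. The first argument tells whether
  a run that already has length at least 2 is being read.\<close>

fun run_word :: "bool \<Rightarrow> nat \<Rightarrow> bool list \<Rightarrow> bool" where
  "run_word s r [] \<longleftrightarrow> \<not> s \<and> r = 0"
| "run_word s r (False # xs) \<longleftrightarrow> run_word False r xs"
| "run_word True r (True # xs) \<longleftrightarrow> run_word True r xs"
| "run_word False r [True] \<longleftrightarrow> False"
| "run_word False r (True # False # xs) \<longleftrightarrow> False"
| "run_word False r (True # True # xs) \<longleftrightarrow> r > 0 \<and> run_word True (r - 1) xs"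

section \<open>Counting linear words whose runs have length at least 2\<close>

definition run_words :: "bool \<Rightarrow> nat \<Rightarrow> nat \<Rightarrow> nat \<Rightarrow> bool list set" where
  "run_words s r a b = {xs. run_word s r xs \<and> count_list xs False = a \<and> count_list xs True = b}"

lemma count_list_bool: "count_list xs False + count_list xs True = length xs"
  by (induction xs) auto

lemma finite_run_words [simp]: "finite (run_words s r a b)"
proof (rule finite_subset)
  show "run_words s r a b \<subseteq> {xs. set xs \<subseteq> UNIV \<and> length xs = a + b}"
    using count_list_bool by (auto simp: run_words_def)
qed (rule finite_lists_length_eq, simp)

lemma run_word_True_imp: "run_word True r xs \<Longrightarrow> count_list xs False > 0"
  by (induction True r xs rule: run_word.induct) auto

text \<open>Recursion on the first letter. By \<open>run_word_True_imp\<close> an open run must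
  still meet a \<open>False\<close>, so this state is treated for \<open>Suc a\<close> only.\<close>

lemma run_words_True_Suc_0: "run_words True r (Suc a) 0 = Cons False ` run_words False r a 0"
proof -
  have "xs \<in> run_words True r (Suc a) 0 \<longleftrightarrow> xs \<in> Cons False ` run_words False r a 0" for xs
    by (cases "(True, r, xs)" rule: run_word.cases) (auto simp: run_words_def)
  then show ?thesis by blast
qed

lemma run_words_True_Suc_Suc:
  "run_words True r (Suc a) (Suc b) =
    Cons False ` run_words False r a (Suc b) \<union> Cons True ` run_words True r (Suc a) b"
proof -
  have "xs \<in> run_words True r (Suc a) (Suc b) \<longleftrightarrow>
    xs \<in> Cons False ` run_words False r a (Suc b) \<union> Cons True ` run_words True r (Suc a) b" for xs
    by (cases "(True, r, xs)" rule: run_word.cases) (auto simp: run_words_def)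
  then show ?thesis by blast
qed

lemma run_words_False_0: "run_words False r 0 b = (if r = 0 \<and> b = 0 then {[]} else {})"
proof -
  have "run_word False r xs \<Longrightarrow> count_list xs False = 0 \<Longrightarrow> r = 0 \<and> xs = []" for xs
    by (cases "(False, r, xs)" rule: run_word.cases) (auto dest: run_word_True_imp)
  then show ?thesis by (force simp: run_words_def)
qed

text \<open>A run that opens must have length at least 2, so two letters are consumed at once; hence
  \<open>b - 2\<close> and \<open>r - 1\<close>.\<close>

lemma run_words_False_Suc:
  "run_words False r (Suc a) b =
    Cons False ` run_words False r a b \<union>
    (if r > 0 \<and> b > 1 then (\<lambda>xs. True # True # xs) ` run_words True (r - 1) (Suc a) (b - 2) else {})"
proof -
  have "xs \<in> run_words False r (Suc a) b \<longleftrightarrow> xs \<in> Cons False ` run_words False r a b \<union>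
    (if r > 0 \<and> b > 1 then (\<lambda>xs. True # True # xs) ` run_words True (r - 1) (Suc a) (b - 2) else {})" for xs
    by (cases "(False, r, xs)" rule: run_word.cases) (auto simp: run_words_def)
  then show ?thesis by blast
qed

lemma choose_split: "b > r \<Longrightarrow> r > 0 \<Longrightarrow>
   (b - r) choose r = ((b - r - 1) choose r) + ((b - r - 1) choose (r - 1))"
  by (cases "b - r"; cases r) auto

text \<open>Every run is closed by a \<open>False\<close>. Outside a run, choose which
  \<open>r\<close> of the \<open>a\<close> letters \<open>False\<close> close one, and write
  \<open>b\<close> as a sum of \<open>r\<close> parts of size at least 2. Inside a run, the first
  \<open>False\<close> closes it, and its remaining length is one further part that may be
  0.\<close>

lemma card_run_words:
  "card (run_words False r a b) =
    (if r = 0 then of_bool (b = 0) else if b < 2 * r then 0 else (a choose r) * ((b - r - 1) choose (r - 1)))"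
  "card (run_words True r (Suc a) b) = (a choose r) * (if b < 2 * r then 0 else (b - r) choose r)"
proof (induction "a + b" arbitrary: a b r rule: less_induct)
  case less
  {
    fix a' b' r assume *: "a' + b' < a + b"
    note less(1)[OF *] less(2)[OF *]
  } note IH = this
  have F: "card (run_words False r a b) = (if r = 0 then of_bool (b = 0) else if b < 2 * r then 0
      else (a choose r) * ((b - r - 1) choose (r - 1)))" for r
  proof (cases a)
    case 0
    then show ?thesis by (simp add: run_words_False_0 binomial_eq_0_iff)
  next
    case (Suc a')
    have "card (run_words False r (Suc a') b) = card (run_words False r a' b) +
       (if r > 0 \<and> b > 1 then card (run_words True (r - 1) (Suc a') (b - 2)) else 0)"
      unfolding run_words_False_Suc
      by (subst card_Un_disjoint) (auto simp: card_image inj_on_def)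
    also have "\<dots> = (if r = 0 then of_bool (b = 0) else if b < 2 * r then 0
      else (a choose r) * ((b - r - 1) choose (r - 1)))"
      using IH[of a' b r] IH[of a' "b-2" "r-1"]
      by (cases r) (auto simp: Suc algebra_simps)
    finally show ?thesis using Suc by simp
  qed
  \<comment> \<open>Closing the open run leads to words of the same measure \<open>a + b\<close>,
    counted by \<open>F\<close>; extending the run lowers the measure.\<close>
  have T: "card (run_words True r (Suc a) b) = (a choose r) * (if b < 2 * r then 0 else (b - r) choose r)" for r
  proof (cases b)
    case 0
    then show ?thesis
      using F[of r] by (simp add: run_words_True_Suc_0 card_image del: card_0_eq)
  next
    case (Suc b')
    have "card (run_words True r (Suc a) (Suc b')) =
       card (run_words False r a (Suc b')) + card (run_words True r (Suc a) b')"
      unfolding run_words_True_Suc_Suc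
      by (subst card_Un_disjoint) (auto simp: card_image inj_on_def)
    also have "\<dots> = (a choose r) * (if b < 2 * r then 0 else (b - r) choose r)"
      using F[of r] IH[of a b' r] Suc choose_split[of r b]
      by (auto simp: algebra_simps)
    finally show ?thesis using Suc by simp
  qed
  { case 1 show ?case by (rule F) }
  { case 2 show ?case by (rule T) }
qed

lemma card_less_Suc_shift:
  "card {i. i < Suc n \<and> P i} = of_bool (P 0) + card {i. i < n \<and> P (Suc i)}"
proof -
  have "{i. i < Suc n \<and> P i} = (if P 0 then {0} else {}) \<union> Suc ` {i. i < n \<and> P (Suc i)}"
    by (auto simp: less_Suc_eq_0_disj)
  then show ?thesis
    by (auto simp: card_image card_insert_if)
qed

text \<open>The state becomes a letter in front: position \<open>i\<close> of \<open>s # xs\<close>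
  holds the predecessor of \<open>xs ! i\<close>, so a run starts where a \<open>False\<close> there
  meets a \<open>True\<close> in \<open>xs\<close>. This positional form can be compared with
  subsets of a cycle.\<close>

lemma run_word_iff:
  "run_word s r xs \<longleftrightarrow> \<not> last (s # xs) \<and>
    card {i. i < length xs \<and> \<not> (s # xs) ! i \<and> xs ! i} = r \<and>
    (\<forall>i < length xs. \<not> (s # xs) ! i \<and> xs ! i \<longrightarrow> Suc i < length xs \<and> xs ! Suc i)"
proof (induction s r xs rule: run_word.induct)
  case (1 s r) show ?case by simp
next
  case (2 s r xs)
  then show ?case by (simp add: card_less_Suc_shift All_less_Suc2)
next
  case (3 r xs)
  then show ?case by (simp add: card_less_Suc_shift All_less_Suc2)
next
  case (4 r)
  then show ?case by (simp add: card_less_Suc_shift All_less_Suc2)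
next
  case (5 r xs)
  then show ?case by (simp add: card_less_Suc_shift All_less_Suc2)
next
  case (6 r xs)
  have "last (False # True # True # xs) = last (True # xs)" by simp
  with 6 show ?case by (cases r) (simp_all add: card_less_Suc_shift All_less_Suc2 del: last.simps)
qed

section \<open>Rotation of the cycle and double counting of run starts\<close>

definition cyc_next :: "nat \<Rightarrow> nat \<Rightarrow> nat" where
  "cyc_next m i = (if Suc i = m then 0 else Suc i)"

definition cyc_prev :: "nat \<Rightarrow> nat \<Rightarrow> nat" where
  "cyc_prev m i = (if i = 0 then m - 1 else i - 1)"

lemma cyc_simps [simp]:
  assumes "i < m"
  shows "cyc_next m i < m" "cyc_prev m i < m" "cyc_prev m (cyc_next m i) = i"
    "cyc_next m (cyc_prev m i) = i"
  using assms by (auto simp: cyc_next_def cyc_prev_def)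

lemma inj_on_cyc_next: "inj_on (cyc_next m) {..<m}"
  by (rule inj_on_inverseI[of _ "cyc_prev m"]) auto

definition run_starts :: "nat \<Rightarrow> nat set \<Rightarrow> nat set" where
  "run_starts m T = {i \<in> T. cyc_prev m i \<notin> T}"

definition no_isolated :: "nat \<Rightarrow> nat set \<Rightarrow> bool" where
  "no_isolated m T \<longleftrightarrow> (\<forall>i \<in> T. cyc_prev m i \<in> T \<or> cyc_next m i \<in> T)"

definition run_family :: "nat \<Rightarrow> nat \<Rightarrow> nat \<Rightarrow> nat set set" where
  "run_family m j r = {T. T \<subseteq> {..<m} \<and> card T = j \<and> no_isolated m T \<and> card (run_starts m T) = r}"

lemma finite_run_family [simp]: "finite (run_family m j r)"
  by (rule finite_subset[of _ "Pow {..<m}"]) (auto simp: run_family_def)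

lemma in_image_cyc_next:
  assumes "T \<subseteq> {..<m}" "i < m"
  shows "i \<in> cyc_next m ` T \<longleftrightarrow> cyc_prev m i \<in> T"
proof
  assume "i \<in> cyc_next m ` T"
  then obtain t where "t \<in> T" "i = cyc_next m t" by blast
  with assms show "cyc_prev m i \<in> T" by auto
next
  assume "cyc_prev m i \<in> T"
  then have "cyc_next m (cyc_prev m i) \<in> cyc_next m ` T" by blast
  with assms show "i \<in> cyc_next m ` T" by simp
qed

lemma run_starts_rotate:
  assumes "T \<subseteq> {..<m}"
  shows "run_starts m (cyc_next m ` T) = cyc_next m ` run_starts m T"
  using assms by (auto simp: run_starts_def in_image_cyc_next subset_iff)

lemma no_isolated_rotate:
  assumes "T \<subseteq> {..<m}" "no_isolated m T"
  shows "no_isolated m (cyc_next m ` T)"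
  using assms by (auto simp: no_isolated_def in_image_cyc_next subset_iff)

lemma run_family_rotate:
  assumes "T \<in> run_family m j r"
  shows "cyc_next m ` T \<in> run_family m j r"
proof -
  have T: "T \<subseteq> {..<m}" using assms by (simp add: run_family_def)
  then have "run_starts m T \<subseteq> {..<m}" by (auto simp: run_starts_def)
  with assms T show ?thesis
    by (auto simp: run_family_def run_starts_rotate no_isolated_rotate card_image
        inj_on_subset[OF inj_on_cyc_next])
qed

text \<open>Rotation by one step is injective on sets, preserves the family and moves a start at
  \<open>k\<close> to its successor.\<close>

lemma card_run_family_start_le:
  assumes "k < m"
  shows "card {T \<in> run_family m j r. k \<in> run_starts m T}
    \<le> card {T \<in> run_family m j r. cyc_next m k \<in> run_starts m T}"
proof (rule card_inj_on_le[where f = "image (cyc_next m)"])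
  show "inj_on ((`) (cyc_next m)) {T \<in> run_family m j r. k \<in> run_starts m T}"
    by (rule inj_on_subset[OF inj_on_image_Pow[OF inj_on_cyc_next[of m]]])
      (auto simp: run_family_def)
  have "cyc_next m k \<in> run_starts m (cyc_next m ` T)"
    if "T \<in> run_family m j r" "k \<in> run_starts m T" for T
    using that by (subst run_starts_rotate) (auto simp: run_family_def)
  then show "(`) (cyc_next m) ` {T \<in> run_family m j r. k \<in> run_starts m T}
    \<subseteq> {T \<in> run_family m j r. cyc_next m k \<in> run_starts m T}"
    by (auto intro: run_family_rotate)
qed auto

text \<open>The inequalities of \<open>card_run_family_start_le\<close> lead once around the cycle,
  the last one wrapping from \<open>m - 1\<close> to 0, so all of them are equalities.\<close>

lemma card_run_family_start:
  assumes "k < m"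
  shows "card {T \<in> run_family m j r. k \<in> run_starts m T}
    = card {T \<in> run_family m j r. 0 \<in> run_starts m T}"
proof -
  define c where "c k = card {T \<in> run_family m j r. k \<in> run_starts m T}" for k
  have step: "c k \<le> c (cyc_next m k)" if "k < m" for k
    using card_run_family_start_le[OF that] by (simp add: c_def)
  have mono: "k' < m \<Longrightarrow> k \<le> k' \<Longrightarrow> c k \<le> c k'" for k k'
  proof (induction k')
    case (Suc k')
    then show ?case
      using step[of k'] by (cases "k = Suc k'") (auto simp: cyc_next_def)
  qed simp
  have "c 0 \<le> c k" "c k \<le> c (m - 1)" "c (m - 1) \<le> c 0"
    using assms mono[of k 0] mono[of "m - 1" k] step[of "m - 1"] by (auto simp: cyc_next_def)
  then show ?thesis by (simp add: c_def)
qed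

text \<open>By rotational symmetry, each of the \<open>m\<close> positions starts a run in equally many sets.\<close>

lemma run_family_double_count:
  "r * card (run_family m j r) = m * card {T \<in> run_family m j r. 0 \<in> run_starts m T}"
proof -
  have "(\<Sum>T \<in> run_family m j r. card {k \<in> {..<m}. k \<in> run_starts m T})
    = (\<Sum>k<m. card {T \<in> run_family m j r. 0 \<in> run_starts m T})"
    by (rule sum_multicount_gen) (auto intro: card_run_family_start)
  moreover have "card {k \<in> {..<m}. k \<in> run_starts m T} = r" if "T \<in> run_family m j r" for T
  proof -
    have "{k \<in> {..<m}. k \<in> run_starts m T} = run_starts m T"
      using that by (auto simp: run_family_def run_starts_def)
    with that show ?thesis by (simp add: run_family_def)
  qed
  ultimately show ?thesis by (simp add: mult.commute)
qed

section \<open>Cutting the cycle open into words\<close>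

lemma card_set_word: "count_list (map (\<lambda>i. i \<in> T) [0..<m]) True = card (T \<inter> {..<m})"
proof (induction m)
  case (Suc m)
  have "T \<inter> {..<Suc m} = (if m \<in> T then insert m (T \<inter> {..<m}) else T \<inter> {..<m})"
    by (auto simp: less_Suc_eq)
  with Suc show ?case by simp
qed simp

text \<open>The cut lies between \<open>m - 1\<close> and 0. Acceptance forces the last letter to be
  \<open>False\<close>, so the initial state \<open>False\<close> is the correct predecessor of
  position 0 and no run crosses the cut.\<close>

lemma run_word_set_word:
  assumes "T \<subseteq> {..<m}" "m > 0"
  shows "run_word False r (map (\<lambda>i. i \<in> T) [0..<m]) \<longleftrightarrow>
    m - 1 \<notin> T \<and> no_isolated m T \<and> card (run_starts m T) = r"
proof (cases "m - 1 \<in> T")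
  case True
  then show ?thesis using assms by (auto simp: run_word_iff last_map)
next
  case False
  let ?xs = "map (\<lambda>i. i \<in> T) [0..<m]"
  have prev: "(False # ?xs) ! i \<longleftrightarrow> cyc_prev m i \<in> T" if "i < m" for i
    using that False by (cases i) (auto simp: cyc_prev_def)
  have starts: "i < m \<and> \<not> (False # ?xs) ! i \<and> ?xs ! i \<longleftrightarrow> i \<in> run_starts m T" for i
    using assms(1) prev[of i] by (auto simp: run_starts_def)
  \<comment> \<open>A run start differs from \<open>m - 1\<close>, so its cyclic successor does not
    wrap around.\<close>
  have next_in: "Suc i < m \<and> ?xs ! Suc i \<longleftrightarrow> cyc_next m i \<in> T" if "i \<in> run_starts m T" for i
  proof -
    have "i \<in> T" "i < m" using that assms(1) by (auto simp: run_starts_def)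
    then have "Suc i < m" using False by (cases "Suc i = m") auto
    then show ?thesis by (simp add: cyc_next_def)
  qed
  have "{i. i < m \<and> \<not> (False # ?xs) ! i \<and> ?xs ! i} = run_starts m T"
    using starts by blast
  moreover have "(\<forall>i < m. \<not> (False # ?xs) ! i \<and> ?xs ! i \<longrightarrow> Suc i < m \<and> ?xs ! Suc i)
    \<longleftrightarrow> (\<forall>i. i \<in> run_starts m T \<longrightarrow> Suc i < m \<and> ?xs ! Suc i)"
    using starts by blast
  moreover have "\<not> last (False # ?xs)"
    using False assms(2) by (simp add: last_map)
  ultimately have "run_word False r ?xs \<longleftrightarrow> card (run_starts m T) = r \<and>
    (\<forall>i. i \<in> run_starts m T \<longrightarrow> Suc i < m \<and> ?xs ! Suc i)"
    unfolding run_word_iff length_map length_upt minus_nat.diff_0 by simp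
  \<comment> \<open>A member that is no run start has its predecessor in \<open>T\<close>, so only
    run starts can be isolated.\<close>
  also have "(\<forall>i. i \<in> run_starts m T \<longrightarrow> Suc i < m \<and> ?xs ! Suc i) \<longleftrightarrow> no_isolated m T"
    using next_in by (auto simp: no_isolated_def run_starts_def)
  finally show ?thesis using False by auto
qed

text \<open>A start at 0 means \<open>0 \<in> T\<close> and \<open>m - 1 \<notin> T\<close>, so the
  set is an accepted word beginning with \<open>True\<close>. It then begins with two, and the rest
  is read inside a run, with \<open>r - 1\<close> more runs to come.\<close>

lemma card_run_family_start_0:
  assumes "j < m" "r > 0"
  shows "card {T \<in> run_family m j r. 0 \<in> run_starts m T} =
    (if j < 2 * r then 0 else ((m - j - 1) choose (r - 1)) * ((j - r - 1) choose (r - 1)))"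
proof -
  let ?w = "\<lambda>T. map (\<lambda>i. i \<in> T) [0..<m]"
  define A where "A = {T \<in> run_family m j r. 0 \<in> run_starts m T}"
  define B where "B = {xs. run_word False r xs \<and> count_list xs False = m - j \<and>
    count_list xs True = j \<and> hd xs}"
  have m: "m > 0" using assms by simp
  have "inj_on ?w A"
    by (rule inj_on_inverseI[of _ "\<lambda>xs. {i. i < m \<and> xs ! i}"]) (auto simp: A_def run_family_def)
  moreover have "?w ` A = B"
  proof (intro equalityI subsetI)
    fix xs assume "xs \<in> ?w ` A"
    then obtain T where T: "T \<in> A" "xs = ?w T" by blast
    have sub: "T \<subseteq> {..<m}" using T by (auto simp: A_def run_family_def)
    have "m - 1 \<notin> T" "0 \<in> T"
      using T(1) by (auto simp: A_def run_starts_def cyc_prev_def)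
    moreover have "count_list xs True = j"
      using T sub by (simp add: card_set_word A_def run_family_def Int_absorb2)
    moreover have "count_list xs False + count_list xs True = m"
      using T by (simp add: count_list_bool)
    ultimately show "xs \<in> B"
      using T sub m run_word_set_word[OF sub m, of r]
      by (auto simp: A_def B_def run_family_def hd_map)
  next
    fix xs assume xs: "xs \<in> B"
    define T where "T = {i. i < m \<and> xs ! i}"
    have sub: "T \<subseteq> {..<m}" by (auto simp: T_def)
    have len: "length xs = m"
      using xs count_list_bool[of xs] assms by (auto simp: B_def)
    have w: "xs = ?w T" using len by (auto simp: T_def intro!: nth_equalityI)
    have "card T = j"
      using xs sub card_set_word[of T m] w by (simp add: B_def Int_absorb2)
    moreover have "m - 1 \<notin> T \<and> no_isolated m T \<and> card (run_starts m T) = r"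
      using xs w run_word_set_word[OF sub m, of r] by (simp add: B_def)
    moreover have "0 \<in> T" using xs len m by (cases xs) (auto simp: T_def B_def)
    ultimately have "T \<in> A"
      using sub by (auto simp: A_def run_family_def run_starts_def cyc_prev_def)
    with w show "xs \<in> ?w ` A" by blast
  qed
  ultimately have "card A = card B" by (metis card_image)
  \<comment> \<open>\<open>r > 0\<close> rules out the empty word, whose \<open>hd\<close> is
    unspecified. By \<open>j < m\<close>, \<open>Suc (m - j - 1)\<close> is \<open>m - j\<close>, in
    the shape that \<open>card_run_words\<close> expects.\<close>
  moreover have "B = (if j < 2 then {} else
    (\<lambda>xs. True # True # xs) ` run_words True (r - 1) (Suc (m - j - 1)) (j - 2))"
  proof -
    have "xs \<in> B \<longleftrightarrow> 2 \<le> j \<and>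
      xs \<in> (\<lambda>xs. True # True # xs) ` run_words True (r - 1) (Suc (m - j - 1)) (j - 2)" for xs
      using assms
      by (cases "(False, r, xs)" rule: run_word.cases) (auto simp: B_def run_words_def)
    then show ?thesis by (auto split: if_splits)
  qed
  moreover have index_eq: "j - 2 - (r - 1) = j - r - 1" using assms by simp
  ultimately have "card A =
      (if j < 2 then 0 else card (run_words True (r - 1) (Suc (m - j - 1)) (j - 2)))"
    by (simp add: card_image inj_on_def)
  with index_eq show ?thesis
    using assms unfolding card_run_words by (auto simp: A_def[symmetric])
qed

text \<open>Double counting yields \<open>r\<close> times the cardinality. The absorption identity
  \<open>r * (p choose r) = p * ((p - 1) choose (r - 1))\<close> with \<open>p = j - r\<close>
  trades the factor \<open>r\<close> for the denominator \<open>j - r\<close>.\<close>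

lemma card_run_family:
  assumes "j < m" "r > 0" "2 * r \<le> j"
  shows "rat_of_nat (card (run_family m j r)) =
    of_nat m * (of_nat (((m - j - 1) choose (r - 1)) * ((j - r) choose r)) / of_nat (j - r))"
proof -
  define c where "c = (m - j - 1) choose (r - 1)"
  have "r * card (run_family m j r) = m * (c * ((j - r - 1) choose (r - 1)))"
    using assms by (simp add: run_family_double_count card_run_family_start_0 c_def)
  then have *: "rat_of_nat r * of_nat (card (run_family m j r)) =
      of_nat m * (of_nat c * of_nat ((j - r - 1) choose (r - 1)))"
    by (metis of_nat_mult)
  have "r * ((j - r) choose r) = (j - r) * ((j - r - 1) choose (r - 1))"
    using assms by (intro times_binomial_minus1_eq) auto
  then have "rat_of_nat r * of_nat ((j - r) choose r) =
      of_nat (j - r) * of_nat ((j - r - 1) choose (r - 1))"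
    by (metis of_nat_mult)
  with * have "rat_of_nat r * (of_nat (card (run_family m j r)) * of_nat (j - r)) =
      of_nat r * (of_nat m * (of_nat c * of_nat ((j - r) choose r)))"
    by algebra
  moreover have "rat_of_nat r \<noteq> 0" "rat_of_nat (j - r) \<noteq> 0" using assms by auto
  ultimately show ?thesis unfolding c_def[symmetric] of_nat_mult
    by (simp only: mult_cancel_left times_divide_eq_right eq_divide_eq if_False) simp
qed

text \<open>Otherwise \<open>T\<close> is closed under predecessors: descending from a member
  reaches 0, wraps to \<open>m - 1\<close> and then covers every position.\<close>

lemma run_starts_nonempty:
  assumes "T \<subseteq> {..<m}" "T \<noteq> {}" "T \<noteq> {..<m}"
  shows "run_starts m T \<noteq> {}"
proof
  assume empty: "run_starts m T = {}"
  have step: "cyc_prev m i \<in> T" if "i \<in> T" for i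
    using that empty by (auto simp: run_starts_def)
  have down: "k \<le> i \<Longrightarrow> i \<in> T \<Longrightarrow> k \<in> T" for k i
  proof (induction i)
    case (Suc i)
    then show ?case using step[of "Suc i"] by (cases "k = Suc i") (auto simp: cyc_prev_def)
  qed simp
  obtain t where "t \<in> T" using assms by blast
  then have "0 \<in> T" using down[of 0 t] by simp
  then have "m - 1 \<in> T" using step[of 0] by (simp add: cyc_prev_def)
  then have "{..<m} \<subseteq> T" using down[of _ "m - 1"] by auto
  with assms show False by blast
qed

text \<open>Sort by the number \<open>r\<close> of runs: \<open>r > 0\<close> since the set is
  nonempty and proper, and \<open>2 * r \<le> j\<close> since each run has length at least
  2.\<close>

lemma card_no_isolated:
  assumes "1 \<le> j" "j < m"
  shows "rat_of_nat (card {T. T \<subseteq> {..<m} \<and> card T = j \<and> no_isolated m T}) =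
    of_nat m * (\<Sum>r = 1..j div 2.
      of_nat (((m - j - 1) choose (r - 1)) * ((j - r) choose r)) / of_nat (j - r))"
proof -
  have "{T. T \<subseteq> {..<m} \<and> card T = j \<and> no_isolated m T} = (\<Union>r\<in>{1..j div 2}. run_family m j r)"
  proof (intro equalityI subsetI)
    fix T assume "T \<in> {T. T \<subseteq> {..<m} \<and> card T = j \<and> no_isolated m T}"
    then have T: "T \<subseteq> {..<m}" "card T = j" "no_isolated m T" by auto
    define r where "r = card (run_starts m T)"
    have mem: "T \<in> run_family m j r" using T by (simp add: run_family_def r_def)
    have "finite (run_starts m T)"
      using T finite_subset[of "run_starts m T" "{..<m}"] by (auto simp: run_starts_def)
    moreover have "T \<noteq> {}" "T \<noteq> {..<m}" using T assms by auto
    ultimately have "r > 0"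
      using run_starts_nonempty[OF T(1)] by (simp add: r_def card_gt_0_iff)
    \<comment> \<open>The bound is read off the count: for larger \<open>r\<close> the family has
      cardinality 0, yet it contains \<open>T\<close>.\<close>
    have "\<not> j < 2 * r"
    proof
      assume "j < 2 * r"
      then have "r * card (run_family m j r) = 0"
        using run_family_double_count[of r m j] card_run_family_start_0[OF assms(2) \<open>r > 0\<close>] by simp
      with \<open>r > 0\<close> mem show False by auto
    qed
    with \<open>r > 0\<close> mem show "T \<in> (\<Union>r\<in>{1..j div 2}. run_family m j r)" by force
  qed (auto simp: run_family_def)
  moreover have "card (\<Union>r\<in>{1..j div 2}. run_family m j r) =
      (\<Sum>r = 1..j div 2. card (run_family m j r))"
    by (rule card_UN_disjoint) (auto simp: run_family_def)
  moreover have "(\<Sum>r = 1..j div 2. rat_of_nat (card (run_family m j r))) =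
    (\<Sum>r = 1..j div 2. of_nat m *
      (of_nat (((m - j - 1) choose (r - 1)) * ((j - r) choose r)) / of_nat (j - r)))"
    using assms by (intro sum.cong card_run_family) auto
  ultimately show ?thesis by (simp add: sum_distrib_left)
qed

section \<open>Joins and wheels\<close>

lemma Plus_eq_Plus_iff: "A <+> B = C <+> D \<longleftrightarrow> A = C \<and> B = D"
proof
  assume eq: "A <+> B = C <+> D"
  have "A = Inl -` (A <+> B)" "C = Inl -` (C <+> D)" "B = Inr -` (A <+> B)" "D = Inr -` (C <+> D)"
    by auto
  with eq show "A = C \<and> B = D" by metis
qed simp

lemma set_sum_cases:
  obtains A B where "S = A <+> B"
proof
  show "S = Inl -` S <+> Inr -` S"
  proof (intro set_eqI)
    fix x show "x \<in> S \<longleftrightarrow> x \<in> Inl -` S <+> Inr -` S" by (cases x) auto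
  qed
qed

lemma Plus_Diff_Plus: "(A <+> B) - (C <+> D) = (A - C) <+> (B - D)"
  by auto

lemma degree_in_graph_join_Inl:
  assumes "a \<in> pverts G" "finite A" "finite B" "B \<subseteq> pverts H"
  shows "degree_in (graph_join G H) (A <+> B) (Inl a) = degree_in G A a + card B"
proof -
  have "{u \<in> A <+> B. (Inl a, u) \<in> parcs (graph_join G H)} = {u \<in> A. (a, u) \<in> parcs G} <+> B"
    using assms by auto
  then show ?thesis using assms by (simp add: degree_in_def card_Plus)
qed

lemma degree_in_graph_join_Inr:
  assumes "b \<in> pverts H" "finite A" "finite B" "A \<subseteq> pverts G"
  shows "degree_in (graph_join G H) (A <+> B) (Inr b) = card A + degree_in H B b"
proof -
  have "{u \<in> A <+> B. (Inr b, u) \<in> parcs (graph_join G H)} = A <+> {u \<in> B. (b, u) \<in> parcs H}"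
    using assms by auto
  then show ?thesis using assms by (simp add: degree_in_def card_Plus)
qed

text \<open>All vertices of the other factor are neighbours, so they add their number inside the set
  minus their number outside.\<close>

lemma alliance_slack_graph_join:
  assumes "pair_graph G" "pair_graph H" "A \<subseteq> pverts G" "B \<subseteq> pverts H"
  shows "a \<in> A \<Longrightarrow> alliance_slack (graph_join G H) (A <+> B) (Inl a) =
      alliance_slack G A a + int (card B) - int (card (pverts H - B))"
    and "b \<in> B \<Longrightarrow> alliance_slack (graph_join G H) (A <+> B) (Inr b) =
      alliance_slack H B b + int (card A) - int (card (pverts G - A))"
proof -
  interpret G: pair_graph G by fact
  interpret H: pair_graph H by fact
  have "finite A" "finite B"
    using assms finite_subset G.pair_finite_verts H.pair_finite_verts by blast+
  with assms show "a \<in> A \<Longrightarrow> alliance_slack (graph_join G H) (A <+> B) (Inl a) =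
      alliance_slack G A a + int (card B) - int (card (pverts H - B))"
    "b \<in> B \<Longrightarrow> alliance_slack (graph_join G H) (A <+> B) (Inr b) =
      alliance_slack H B b + int (card A) - int (card (pverts G - A))"
    by (auto simp: alliance_slack_def Plus_Diff_Plus degree_in_graph_join_Inl
        degree_in_graph_join_Inr subset_iff G.pair_finite_verts H.pair_finite_verts)
qed

section \<open>Slacks in the cycle and in the single vertex\<close>

lemma parcs_cycle_graph_iff:
  assumes "i < m"
  shows "(i, u) \<in> parcs (cycle_graph m) \<longleftrightarrow> u = cyc_next m i \<or> u = cyc_prev m i"
proof -
  have next_eq: "Suc k mod m = cyc_next m k" if "k < m" for k
    using that by (auto simp: cyc_next_def)
  have "(i, u) \<in> parcs (cycle_graph m) \<longleftrightarrow> u < m \<and> (u = cyc_next m i \<or> i = cyc_next m u)"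
    using assms by (auto simp: cycle_graph_def next_eq)
  then show ?thesis using assms by (metis cyc_simps)
qed

lemma degree_in_cycle_graph:
  assumes "i < m" "m \<ge> 3"
  shows "degree_in (cycle_graph m) X i = of_bool (cyc_next m i \<in> X) + of_bool (cyc_prev m i \<in> X)"
proof -
  \<comment> \<open>For \<open>m = 2\<close> both neighbours would coincide.\<close>
  have "cyc_next m i \<noteq> cyc_prev m i" using assms by (auto simp: cyc_next_def cyc_prev_def)
  moreover have "{u \<in> X. (i, u) \<in> parcs (cycle_graph m)} =
      (if cyc_next m i \<in> X then {cyc_next m i} else {}) \<union>
      (if cyc_prev m i \<in> X then {cyc_prev m i} else {})"
    using assms by (auto simp: parcs_cycle_graph_iff)
  ultimately show ?thesis by (simp add: degree_in_def)
qed

text \<open>Each of the two neighbours contributes 1 if it lies in \<open>B\<close> and -1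
  otherwise.\<close>

lemma alliance_slack_cycle_graph:
  assumes "i < m" "m \<ge> 3"
  shows "alliance_slack (cycle_graph m) B i =
    2 * of_bool (cyc_next m i \<in> B) + 2 * of_bool (cyc_prev m i \<in> B) - 2"
  using assms cyc_simps[OF assms(1)]
  by (simp add: alliance_slack_def degree_in_cycle_graph) (simp add: cycle_graph_def)

lemma pverts_cycle_graph [simp]: "pverts (cycle_graph m) = {..<m}"
  by (simp add: cycle_graph_def)

lemma pverts_E1 [simp]: "pverts E1 = {()}"
  by (simp add: E1_def)

lemma alliance_slack_E1: "alliance_slack E1 {()} () = 0"
  by (simp add: alliance_slack_def degree_in_def E1_def)

lemma alliance_poly_E1: "alliance_poly E1 = monom 1 1"
proof -
  have "connected_set E1 {()}" by (rule connected_set_if_dominating[of "()"]) auto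
  then have "{S. S \<subseteq> pverts E1 \<and> connected_set E1 S} = {{()}}"
    by (auto simp: connected_set_iff)
  moreover have "exact_index E1 {()} = 0"
    by (rule exact_index_eqI[where v = "()"]) (auto simp: pair_graph_E1 alliance_slack_E1)
  ultimately show ?thesis by (simp add: alliance_poly_eq pair_graph_E1)
qed

section \<open>Exact indices in the wheel\<close>

context
  fixes m :: nat
  assumes m: "m \<ge> 3"
begin

abbreviation wheel :: "(unit + nat) pair_pre_digraph" where
  "wheel \<equiv> graph_join E1 (cycle_graph m)"

lemma pair_graph_wheel: "pair_graph wheel"
  using m by (intro pair_graph_graph_join pair_graph_E1 pair_graph_cycle_graph)

lemma alliance_slack_hub:
  assumes "B \<subseteq> {..<m}"
  shows "alliance_slack wheel ({()} <+> B) (Inl ()) = 2 * int (card B) - int m"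
proof -
  have "card B \<le> m" "card ({..<m} - B) = m - card B"
    using assms card_mono[OF _ assms] by (auto simp: card_Diff_subset finite_subset)
  then show ?thesis
    using assms m
    by (simp add: alliance_slack_graph_join pair_graph_E1 pair_graph_cycle_graph alliance_slack_E1)
qed

lemma alliance_slack_rim:
  assumes "B \<subseteq> {..<m}" "i \<in> B"
  shows "alliance_slack wheel ({()} <+> B) (Inr i) =
    2 * of_bool (cyc_next m i \<in> B) + 2 * of_bool (cyc_prev m i \<in> B) - 1"
  using assms m
  by (auto simp: alliance_slack_graph_join pair_graph_E1 pair_graph_cycle_graph
      alliance_slack_cycle_graph subset_iff)

text \<open>The absent hub is one more outside neighbour of every vertex and lowers each slack,
  hence the minimum, by one.\<close>

lemma exact_index_hubless:
  assumes "B \<subseteq> {..<m}" "B \<noteq> {}"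
  shows "exact_index wheel ({} <+> B) = exact_index (cycle_graph m) B - 1"
proof -
  have slack: "alliance_slack wheel ({} <+> B) (Inr i) = alliance_slack (cycle_graph m) B i - 1"
    if "i \<in> B" for i
    using that assms m by (simp add: alliance_slack_graph_join pair_graph_E1 pair_graph_cycle_graph)
  obtain v where v: "v \<in> B" "alliance_slack (cycle_graph m) B v = exact_index (cycle_graph m) B"
    "\<And>u. u \<in> B \<Longrightarrow> exact_index (cycle_graph m) B \<le> alliance_slack (cycle_graph m) B u"
    using exact_index_attained[OF pair_graph_cycle_graph[OF m], of B] assms by auto
  show ?thesis
  proof (rule exact_index_eqI[OF pair_graph_wheel, where v = "Inr v"])
    show "{} <+> B \<subseteq> pverts wheel" using assms by auto
    show "Inr v \<in> {} <+> B" using v(1) by auto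
    show "alliance_slack wheel ({} <+> B) (Inr v) = exact_index (cycle_graph m) B - 1"
      using v(1,2) slack[of v] by simp
    fix u :: "unit + nat" assume "u \<in> {} <+> B"
    then obtain b where "b \<in> B" "u = Inr b" by auto
    then show "exact_index (cycle_graph m) B - 1 \<le> alliance_slack wheel ({} <+> B) u"
      using v(3)[of b] slack[of b] by simp
  qed
qed

text \<open>Common criterion for the evaluations below: \<open>v\<close> attains \<open>k\<close>,
  and the two bounds treat hub and rim separately.\<close>

lemma exact_index_hub_eqI:
  assumes "B \<subseteq> {..<m}" "v \<in> {()} <+> B" "alliance_slack wheel ({()} <+> B) v = k"
    and "k \<le> 2 * int (card B) - int m"
    and "\<And>i. i \<in> B \<Longrightarrow> k \<le> 2 * of_bool (cyc_next m i \<in> B) + 2 * of_bool (cyc_prev m i \<in> B) - 1"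
  shows "exact_index wheel ({()} <+> B) = k"
proof (rule exact_index_eqI[OF pair_graph_wheel _ assms(2,3)])
  show "{()} <+> B \<subseteq> pverts wheel" using assms(1) by auto
  fix u assume "u \<in> {()} <+> B"
  then consider "u = Inl ()" | i where "i \<in> B" "u = Inr i" by auto
  then show "k \<le> alliance_slack wheel ({()} <+> B) u"
    by cases (use assms(4,5) in \<open>simp_all only: alliance_slack_hub[OF assms(1)]
        alliance_slack_rim[OF assms(1)]\<close>)
qed

text \<open>The hub slack is negative while rim slacks are at least -1, so the hub attains the
  minimum.\<close>

lemma exact_index_eq_hub:
  assumes "B \<subseteq> {..<m}" "2 * card B < m"
  shows "exact_index wheel ({()} <+> B) = 2 * int (card B) - int m"
  by (rule exact_index_hub_eqI[OF assms(1), where v = "Inl ()"])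
    (use assms(2) in \<open>auto simp: alliance_slack_hub[OF assms(1)]\<close>)

text \<open>An isolated rim vertex has slack -1, the least possible on the rim, and the hub slack is
  nonnegative.\<close>

lemma exact_index_isolated:
  assumes "B \<subseteq> {..<m}" "m \<le> 2 * card B" "\<not> no_isolated m B"
  shows "exact_index wheel ({()} <+> B) = -1"
proof -
  obtain i where i: "i \<in> B" "cyc_prev m i \<notin> B" "cyc_next m i \<notin> B"
    using assms(3) by (auto simp: no_isolated_def)
  show ?thesis
    by (rule exact_index_hub_eqI[OF assms(1), where v = "Inr i"])
      (use assms(2) i in \<open>auto simp: alliance_slack_rim[OF assms(1)]\<close>)
qed

text \<open>All rim slacks are at least 1. If \<open>2 * card B = m\<close>, the hub has slack 0;
  otherwise its slack is at least 1, and a run start attains 1.\<close>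

lemma exact_index_no_isolated:
  assumes "B \<subseteq> {..<m}" "B \<noteq> {..<m}" "m \<le> 2 * card B" "no_isolated m B"
  shows "exact_index wheel ({()} <+> B) = (if 2 * card B = m then 0 else 1)"
proof -
  have rim: "1 \<le> 2 * of_bool (cyc_next m i \<in> B) + 2 * of_bool (cyc_prev m i \<in> B) - (1 :: int)"
    if "i \<in> B" for i
    using that assms(4) by (auto simp: no_isolated_def)
  show ?thesis
  proof (cases "2 * card B = m")
    case True
    then have "2 * int (card B) = int m" by linarith
    then have "exact_index wheel ({()} <+> B) = 0"
      by (intro exact_index_hub_eqI[OF assms(1), where v = "Inl ()"])
        (use rim in \<open>fastforce simp: alliance_slack_hub[OF assms(1)]\<close>)+
    with True show ?thesis by simp
  next
    case False
    with assms(3) have "1 \<le> 2 * int (card B) - int m" by linarith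
    \<comment> \<open>A run start exists as \<open>B\<close> is nonempty and proper; it has exactly
      one neighbour in \<open>B\<close>, which gives slack 2 - 1.\<close>
    have "B \<noteq> {}" using assms m by auto
    then obtain i where "i \<in> B" "cyc_prev m i \<notin> B"
      using run_starts_nonempty[OF assms(1) _ assms(2)] by (auto simp: run_starts_def)
    with assms(4) have i: "i \<in> B" "cyc_prev m i \<notin> B" "cyc_next m i \<in> B"
      by (auto simp: no_isolated_def)
    have "exact_index wheel ({()} <+> B) = 1"
      by (rule exact_index_hub_eqI[OF assms(1), where v = "Inr i"])
        (use \<open>1 \<le> 2 * int (card B) - int m\<close> rim i in
          \<open>auto simp: alliance_slack_rim[OF assms(1)]\<close>)
    with False show ?thesis by simp
  qed
qed

text \<open>Every rim vertex has slack 3, and the hub slack \<open>m\<close> is at least 3.\<close>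

lemma exact_index_full: "exact_index wheel ({()} <+> {..<m}) = 3"
  by (rule exact_index_hub_eqI[where v = "Inr 0"])
    (use m in \<open>auto simp: alliance_slack_rim\<close>)

section \<open>The polynomial of the wheel as a sum over rim parts\<close>

definition hub_term :: "nat set \<Rightarrow> rat poly" where
  "hub_term B = monom 1 (nat (int (m + 1) + exact_index wheel ({()} <+> B)))"

text \<open>For hub-free sets the index drops by one and the order grows by one, so the exponents
  are those of the cycle. With the hub, every rim part, even the empty one, gives a connected
  set.\<close>

lemma alliance_poly_wheel:
  "alliance_poly wheel = alliance_poly (cycle_graph m) + (\<Sum>B \<in> Pow {..<m}. hub_term B)"
proof -
  let ?f = "\<lambda>S. monom (1 :: rat) (nat (int (m + 1) + exact_index wheel S))"
  have "connected_set wheel ({()} <+> B)" if "B \<subseteq> {..<m}" for B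
    using that by (intro connected_set_if_dominating[of "Inl ()"]) auto
  moreover have "connected_set wheel ({} <+> B) \<longleftrightarrow> connected_set (cycle_graph m) B" for B
    by (simp add: Plus_def connected_set_graph_join_Inr)
  ultimately have conn: "connected_set wheel (A <+> B) \<longleftrightarrow> A = {()} \<or> connected_set (cycle_graph m) B"
    if "B \<subseteq> {..<m}" "A = {} \<or> A = {()}" for A B
    using that by blast
  have split: "{S. S \<subseteq> pverts wheel \<and> connected_set wheel S} =
    (<+>) {} ` {B. B \<subseteq> {..<m} \<and> connected_set (cycle_graph m) B} \<union> (<+>) {()} ` Pow {..<m}"
  proof (intro set_eqI)
    fix S :: "(unit + nat) set"
    obtain A B where S: "S = A <+> B" by (rule set_sum_cases)
    have "A = {} \<or> A = {()}" by auto
    moreover have "A <+> B \<subseteq> pverts wheel \<longleftrightarrow> B \<subseteq> {..<m}" by auto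
    ultimately show "S \<in> {S. S \<subseteq> pverts wheel \<and> connected_set wheel S} \<longleftrightarrow>
      S \<in> (<+>) {} ` {B. B \<subseteq> {..<m} \<and> connected_set (cycle_graph m) B} \<union> (<+>) {()} ` Pow {..<m}"
      unfolding S by (auto simp: conn Plus_eq_Plus_iff image_iff simp del: pverts_graph_join)
  qed
  have "card (pverts wheel) = m + 1" by (simp add: card_Plus)
  then have "alliance_poly wheel = sum ?f {S. S \<subseteq> pverts wheel \<and> connected_set wheel S}"
    by (simp only: alliance_poly_eq[OF pair_graph_wheel])
  also have "\<dots> = sum ?f ((<+>) {} ` {B. B \<subseteq> {..<m} \<and> connected_set (cycle_graph m) B}) +
      sum ?f ((<+>) {()} ` Pow {..<m})"
    unfolding split by (rule sum.union_disjoint) (auto simp: Plus_eq_Plus_iff)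
  also have "sum ?f ((<+>) {()} ` Pow {..<m}) = (\<Sum>B \<in> Pow {..<m}. hub_term B)"
    by (subst sum.reindex) (auto simp: inj_on_def Plus_eq_Plus_iff hub_term_def)
  also have "sum ?f ((<+>) {} ` {B. B \<subseteq> {..<m} \<and> connected_set (cycle_graph m) B}) =
      alliance_poly (cycle_graph m)"
    unfolding alliance_poly_eq[OF pair_graph_cycle_graph[OF m]]
    by (subst sum.reindex)
      (auto simp: inj_on_def Plus_eq_Plus_iff exact_index_hubless connected_set_iff intro!: sum.cong)
  finally show ?thesis .
qed

text \<open>The hub alone has index \<open>- m\<close>; its monomial is the one that the theorem
  writes as the polynomial of \<open>E1\<close>.\<close>

lemma hub_term_empty: "hub_term {} = monom 1 1"
  using m by (simp add: hub_term_def exact_index_eq_hub)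

lemma hub_term_full: "hub_term {..<m} = monom 1 (m + 4)"
  using m by (simp add: hub_term_def exact_index_full nat_add_distrib add.commute)

lemma sum_hub_term_lt:
  assumes "2 * j < m"
  shows "(\<Sum>B | B \<subseteq> {..<m} \<and> card B = j. hub_term B) = monom (of_nat (m choose j)) (2 * j + 1)"
proof -
  have "nat (int (m + 1) + (2 * int j - int m)) = 2 * j + 1" by linarith
  then have "(\<Sum>B | B \<subseteq> {..<m} \<and> card B = j. hub_term B) =
    (\<Sum>B | B \<subseteq> {..<m} \<and> card B = j. monom 1 (2 * j + 1))"
    using assms m by (intro sum.cong) (auto simp: hub_term_def exact_index_eq_hub)
  then show ?thesis by (simp only: sum_monom_const) (simp add: n_subsets)
qed

text \<open>In the coefficients \<open>n\<close> and \<open>k\<close> also count the hub, so they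
  are \<open>Suc m\<close> and \<open>Suc j\<close>.\<close>

lemma card_no_isolated_coeff_b:
  assumes "1 \<le> j" "j < m"
  shows "rat_of_nat (card {B. B \<subseteq> {..<m} \<and> card B = j \<and> no_isolated m B}) =
    coeff_b (Suc m) (Suc j)"
  using assms by (simp add: card_no_isolated coeff_b_def)

text \<open>Rim parts with an isolated vertex give index -1, the others index 0 or 1, to be added to
  the order \<open>m + 1\<close>. The two coefficients count these classes and are complementary in
  \<open>m choose j\<close>.\<close>

lemma sum_hub_term_ge:
  assumes "m \<le> 2 * j" "j < m"
  shows "(\<Sum>B | B \<subseteq> {..<m} \<and> card B = j. hub_term B) =
    monom (coeff_a (Suc m) (Suc j)) m +
    monom (coeff_b (Suc m) (Suc j)) (if 2 * j = m then m + 1 else m + 2)"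
proof -
  define e where "e = (if 2 * j = m then m + 1 else m + 2)"
  define X where "X = {B. B \<subseteq> {..<m} \<and> card B = j \<and> no_isolated m B}"
  define Y where "Y = {B. B \<subseteq> {..<m} \<and> card B = j \<and> \<not> no_isolated m B}"
  have "j \<ge> 1" using assms by simp
  have fin: "finite X" "finite Y"
    by (rule finite_subset[of _ "Pow {..<m}"]; force simp: X_def Y_def)+
  have XY: "{B. B \<subseteq> {..<m} \<and> card B = j} = X \<union> Y" "X \<inter> Y = {}"
    by (auto simp: X_def Y_def)
  have "m choose j = card X + card Y"
    using n_subsets[of "{..<m}" j] fin XY by (simp add: card_Un_disjoint)
  then have Y: "rat_of_nat (card Y) = coeff_a (Suc m) (Suc j)"
    using \<open>j \<ge> 1\<close> assms by (simp add: coeff_a_def X_def flip: card_no_isolated_coeff_b)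
  have X: "rat_of_nat (card X) = coeff_b (Suc m) (Suc j)"
    using \<open>j \<ge> 1\<close> assms by (simp add: X_def card_no_isolated_coeff_b)
  have "hub_term B = monom 1 m" if "B \<in> Y" for B
    using that assms m by (simp add: Y_def hub_term_def exact_index_isolated)
  moreover have "hub_term B = monom 1 e" if "B \<in> X" for B
  proof -
    have "exact_index wheel ({()} <+> B) = (if 2 * j = m then 0 else 1)"
      using that assms m by (subst exact_index_no_isolated) (auto simp: X_def)
    then show ?thesis using m by (simp add: hub_term_def e_def nat_add_distrib)
  qed
  ultimately have "(\<Sum>B \<in> X \<union> Y. hub_term B) = (\<Sum>B \<in> X. monom 1 e) + (\<Sum>B \<in> Y. monom 1 m)"
    using fin XY by (simp only: sum.union_disjoint cong: sum.cong)
  then show ?thesis unfolding XY sum_monom_const X Y e_def by simp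
qed

text \<open>Sort by the size \<open>k\<close> of the alliance including the hub. The extreme rim
  parts are split off: the empty one supplies the \<open>E1\<close> term, and the full rim has no
  run start, so its index is exceptional.\<close>

lemma sum_hub_term:
  "(\<Sum>B \<in> Pow {..<m}. hub_term B) = monom 1 1 + (\<Sum>k = 2..m.
    \<Sum>B | B \<subseteq> {..<m} \<and> card B = k - 1. hub_term B) + monom 1 (m + 4)"
proof -
  define c where "c j = (\<Sum>B | B \<subseteq> {..<m} \<and> card B = j. hub_term B)" for j
  have card_le: "card B \<le> m" if "B \<subseteq> {..<m}" for B
    using card_mono[OF _ that] by simp
  have "{B. B \<subseteq> {..<m} \<and> card B = 0} = {{}}"
    using finite_subset[of _ "{..<m}"] by auto
  then have c0: "c 0 = monom 1 1" unfolding c_def by (simp add: hub_term_empty)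
  have "{B. B \<subseteq> {..<m} \<and> card B = m} = {{..<m}}"
    using card_subset_eq[of "{..<m}"] by auto
  then have cm: "c m = monom 1 (m + 4)" unfolding c_def by (simp add: hub_term_full)
  have "(\<Sum>B \<in> Pow {..<m}. hub_term B) = (\<Sum>j \<in> {..m}. \<Sum>B | B \<in> Pow {..<m} \<and> card B = j. hub_term B)"
    by (rule sum.group[symmetric]) (auto intro: card_le)
  also have "\<dots> = sum c {..m}" by (simp add: c_def)
  also have "{..m} = insert 0 (insert m {1..m - 1})" using m by auto
  also have "sum c (insert 0 (insert m {1..m - 1})) = c 0 + sum c {1..m - 1} + c m"
    using m by (simp add: algebra_simps)
  also have "sum c {1..m - 1} = (\<Sum>k = 2..m. c (k - 1))"
    using m by (intro sum.reindex_bij_witness[of _ "\<lambda>k. k - 1" Suc]) auto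
  finally show ?thesis by (simp only: c0 cm) (simp only: c_def)
qed

end

section \<open>Collecting the summands\<close>

theorem proposition3:
  fixes n :: nat
  assumes "n \<ge> 4"
  shows "alliance_poly (wheel_graph n) =
    alliance_poly E1
    + alliance_poly (cycle_graph (n - 1))
    + (\<Sum>k = 2..n div 2. monom (of_nat ((n - 1) choose (k - 1))) (2 * k - 1))
    + (\<Sum>k = n div 2 + 1..n - 1. monom (coeff_a n k) (n - 1))
    + monom (xi n * coeff_b n ((n + 1) div 2)) n
    + (\<Sum>k = (n + 1) div 2 + 1..n - 1. monom (coeff_b n k) (n + 1))
    + monom 1 (n + 3)"
proof -
  define m where "m = n - 1"
  have m: "m \<ge> 3" and n: "n = Suc m" using assms by (simp_all add: m_def)
  define c where "c k = (\<Sum>B | B \<subseteq> {..<m} \<and> card B = k - 1. hub_term m B)" for k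
  \<comment> \<open>The exceptional exponent, where the hub slack is 0, stays inside the summand
    until the range of summation is split.\<close>
  define b where "b k = monom (coeff_b n k) (if 2 * k = n + 1 then n else n + 1)" for k
  have small: "c k = monom (of_nat ((n - 1) choose (k - 1))) (2 * k - 1)"
    if "k \<in> {2..n div 2}" for k
  proof -
    have "2 * (k - 1) < m" "2 * (k - 1) + 1 = 2 * k - 1" using that n by auto
    then show ?thesis using m unfolding c_def by (simp only: sum_hub_term_lt m_def)
  qed
  have large: "c k = monom (coeff_a n k) (n - 1) + b k" if "k \<in> {n div 2 + 1..n - 1}" for k
  proof -
    have "m \<le> 2 * (k - 1)" "k - 1 < m" "Suc (k - 1) = k" using that n by auto
    moreover have "2 * (k - 1) = m \<longleftrightarrow> 2 * k = n + 1" using that n by auto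
    ultimately show ?thesis using m sum_hub_term_ge[of m "k - 1"] n unfolding c_def b_def by simp
  qed
  have "{2..m} = {2..n div 2} \<union> {n div 2 + 1..n - 1}" using n m by auto
  then have "sum c {2..m} = sum c {2..n div 2} + sum c {n div 2 + 1..n - 1}"
    by (simp add: sum.union_disjoint)
  also have "\<dots> = (\<Sum>k = 2..n div 2. monom (of_nat ((n - 1) choose (k - 1))) (2 * k - 1))
    + (\<Sum>k = n div 2 + 1..n - 1. monom (coeff_a n k) (n - 1)) + (\<Sum>k = n div 2 + 1..n - 1. b k)"
    by (simp only: small large sum.distrib add.assoc cong: sum.cong)
  also have "(\<Sum>k = n div 2 + 1..n - 1. b k) = monom (xi n * coeff_b n ((n + 1) div 2)) n
    + (\<Sum>k = (n + 1) div 2 + 1..n - 1. monom (coeff_b n k) (n + 1))"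
  proof -
    \<comment> \<open>In this range \<open>2 * k\<close> exceeds \<open>n + 1\<close>, so the
      exceptional exponent does not occur.\<close>
    have rest: "(\<Sum>k = (n + 1) div 2 + 1..n - 1. b k) =
      (\<Sum>k = (n + 1) div 2 + 1..n - 1. monom (coeff_b n k) (n + 1))"
      by (rule sum.cong) (auto simp: b_def)
    show ?thesis
    proof (cases "even n")
      case True
      \<comment> \<open>For even \<open>n\<close>, \<open>n div 2\<close> and
        \<open>(n + 1) div 2\<close> agree and \<open>xi n\<close> is 0.\<close>
      then show ?thesis using rest by (simp add: xi_def)
    next
      case False
      \<comment> \<open>For odd \<open>n\<close> the range begins with the exceptional index, which
        is split off as the first summand.\<close>
      then have "n div 2 + 1 = (n + 1) div 2" "2 * ((n + 1) div 2) = n + 1" by presburger+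
      moreover have "(n + 1) div 2 \<le> n - 1" using assms by linarith
      moreover have "b ((n + 1) div 2) = monom (coeff_b n ((n + 1) div 2)) n"
        unfolding b_def if_P[OF \<open>2 * ((n + 1) div 2) = n + 1\<close>] ..
      ultimately have "(\<Sum>k = n div 2 + 1..n - 1. b k) =
        monom (coeff_b n ((n + 1) div 2)) n + (\<Sum>k = (n + 1) div 2 + 1..n - 1. b k)"
        by (simp only: sum.atLeast_Suc_atMost Suc_eq_plus1)
      then show ?thesis using False rest by (simp add: xi_def)
    qed
  qed
  finally have middle: "sum c {2..m} =
    (\<Sum>k = 2..n div 2. monom (of_nat ((n - 1) choose (k - 1))) (2 * k - 1))
    + (\<Sum>k = n div 2 + 1..n - 1. monom (coeff_a n k) (n - 1))
    + (monom (xi n * coeff_b n ((n + 1) div 2)) n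
    + (\<Sum>k = (n + 1) div 2 + 1..n - 1. monom (coeff_b n k) (n + 1)))" .
  have "alliance_poly (wheel_graph n) = alliance_poly (wheel m)"
    by (simp add: wheel_graph_def m_def)
  also have "\<dots> = alliance_poly (cycle_graph m) + (monom 1 1 + sum c {2..m} + monom 1 (m + 4))"
    unfolding c_def using m by (simp only: alliance_poly_wheel sum_hub_term)
  finally show ?thesis
    unfolding middle alliance_poly_E1 using n by (simp add: algebra_simps)
qed

end
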